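(* Let $-1<B<A\leq1$. Then $\mathcal{S}^*[A,B]\subset\mathcal{S}^*_{Ne}$ if the parameters $A$ and $B$ satisfy any one of the following conditions: (3a) $(1-B^2)<3(1-AB)\leq3(1-B^2)$ and $(1-B)\leq3(1-A)$; (3b) $3(1-B^2)\leq3(1-AB)<5(1-B^2)$ and $3(1+A)\leq5(1+B)$.
   Context: $\mathbb{D}$ is the open unit disk. $\mathcal{A}$ is the set of analytic functions $f$ on $\mathbb{D}$ with $f(0)=0$ and $f'(0)=1$. For analytic $f,g$ on $\mathbb{D}$, $f\prec g$ means there is an analytic $w$ on $\mathbb{D}$ with $w(0)=0$, $|w(z)|<1$ and $f(z)=g(w(z))$ on $\mathbb{D}$. $\mathcal{S}^*[A,B]$ is the Janowski class of all $f\in\mathcal{A}$ with $zf'(z)/f(z)\prec(1+Az)/(1+Bz)$, and $\mathcal{S}^*_{Ne}$ is the class of all $f\in\mathcal{A}$ with $zf'(z)/f(z)\prec 1+z-z^3/3$. *)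

theory Defs
  imports "HOL-Complex_Analysis.Complex_Analysis"
begin

definition normalized_analytic :: "(complex \<Rightarrow> complex) set" where
  "normalized_analytic = {f. f holomorphic_on ball 0 1 \<and> f 0 = 0 \<and> deriv f 0 = 1}"

definition subordinate :: "(complex \<Rightarrow> complex) \<Rightarrow> (complex \<Rightarrow> complex) \<Rightarrow> bool"
    (infix "\<prec>\<^sub>D" 50) where
  "f \<prec>\<^sub>D g \<longleftrightarrow>
     f holomorphic_on ball 0 1 \<and> g holomorphic_on ball 0 1 \<and>
     (\<exists>w. w holomorphic_on ball 0 1 \<and> w 0 = 0 \<and> (\<forall>z\<in>ball 0 1. norm (w z) < 1) \<and>
          (\<forall>z\<in>ball 0 1. f z = g (w z)))"

text \<open>
  The quotient z f'(z) / f(z) has a removable singularity at 0 when f is normalized; its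
  value there is the limit, namely 1, which \<^const>\<open>remove_sings\<close> supplies in place of the value
  0 that totalized division would give. A zero of f elsewhere in the disk gives a genuine pole
  of the quotient, so such f fail the analyticity demanded by \<^const>\<open>subordinate\<close>.
\<close>
definition starlike_quotient :: "(complex \<Rightarrow> complex) \<Rightarrow> complex \<Rightarrow> complex" where
  "starlike_quotient f = remove_sings (\<lambda>z. z * deriv f z / f z)"

definition janowski_class :: "real \<Rightarrow> real \<Rightarrow> (complex \<Rightarrow> complex) set" where
  "janowski_class A B =
     {f \<in> normalized_analytic.
        starlike_quotient f \<prec>\<^sub>D (\<lambda>z. (1 + of_real A * z) / (1 + of_real B * z))}"

definition nephroid_class :: "(complex \<Rightarrow> complex) set" where
  "nephroid_class =
     {f \<in> normalized_analytic. starlike_quotient f \<prec>\<^sub>D (\<lambda>z. 1 + z - z ^ 3 / 3)}"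

end

theory Submission
  imports Defs
begin

text \<open>
  The nephroid domain contains the disc of centre 1 and radius 2/3, because the map
  z \<mapsto> z - z^3/3 is injective on the unit disc and covers the disc of radius 2/3; so every
  holomorphic q with q(0) = 1 and |q - 1| < 2/3 is subordinate to 1 + z - z^3/3. Either parameter
  condition amounts to A - B \<le> (2/3)(1 - |B|), which is what
  |(1 + Aw)/(1 + Bw) - 1| < 2/3 requires for |w| < 1.
\<close>

text \<open>If distinct z and w had the same image, dividing the difference of the images by z - w
  would leave z^2 + z*w + w^2 = 3, but in the open disc the left side has modulus below 3.\<close>

lemma inj_on_nephroid_cubic: "inj_on (\<lambda>z::complex. z - z ^ 3 / 3) (ball 0 1)"
proof (rule inj_onI, rule ccontr)
  fix z w :: complex
  assume "z \<in> ball 0 1" "w \<in> ball 0 1" and eq: "z - z ^ 3 / 3 = w - w ^ 3 / 3" and "z \<noteq> w"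
  then have z: "norm z < 1" and w: "norm w < 1" by auto
  have "(z - w) * (z * z + z * w + w * w - 3) = 3 * ((w - w ^ 3 / 3) - (z - z ^ 3 / 3))"
    by (simp add: algebra_simps power3_eq_cube)
  also have "\<dots> = 0" using eq by simp
  finally have "(z - w) * (z * z + z * w + w * w - 3) = 0" .
  with \<open>z \<noteq> w\<close> have "z * z + z * w + w * w = 3" by simp
  then have "3 = norm (z * z + z * w + w * w)" by simp
  also have "\<dots> \<le> norm z * norm z + norm z * norm w + norm w * norm w"
    by (intro norm_triangle_mono) (simp_all add: norm_mult)
  also have "\<dots> < 1 * 1 + 1 * 1 + 1 * 1"
    using z w by (intro add_strict_mono mult_strict_mono') auto
  finally show False by simp
qed

text \<open>A preimage of c is a fixed point of z \<mapsto> c + z^3/3, so Brouwer's theorem on the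
  closed unit disc provides one.\<close>

lemma nephroid_cubic_covers:
  fixes c :: complex
  assumes "norm c < 2 / 3"
  obtains z where "norm z < 1" and "z - z ^ 3 / 3 = c"
proof -
  \<comment> \<open>The bound 2/3 + 1/3 = 1 is strict even for |z| = 1: this gives the self-map of
    the closed disc and later places the fixed point in the open disc.\<close>
  have bound: "norm (c + z ^ 3 / 3) < 1" if "norm z \<le> 1" for z
  proof -
    have "norm z ^ 3 \<le> 1" using that by (simp add: power_le_one)
    then have "norm (z ^ 3 / 3) \<le> 1 / 3" by (simp add: norm_divide norm_power)
    then show ?thesis using assms norm_triangle_ineq[of c "z ^ 3 / 3"] by linarith
  qed
  obtain z where z: "z \<in> cball 0 1" "c + z ^ 3 / 3 = z"
  proof (rule brouwer_ball[of 1 0 "\<lambda>z. c + z ^ 3 / 3"])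
    show "continuous_on (cball 0 1) (\<lambda>z. c + z ^ 3 / 3)" by (intro continuous_intros) auto
    show "(\<lambda>z. c + z ^ 3 / 3) \<in> cball 0 1 \<rightarrow> cball 0 1"
      using bound by (force intro: less_imp_le)
  qed (auto simp del: mem_cball)
  show thesis
  proof
    show "norm z < 1" using bound[of z] z by simp
    show "z - z ^ 3 / 3 = c" using z(2) by (metis add_diff_cancel_right')
  qed
qed

text \<open>The Schwarz function is q - 1 followed by the inverse of the cubic; that inverse is
  holomorphic because the cubic is injective and holomorphic.\<close>

lemma subordinate_nephroidI:
  assumes q: "q holomorphic_on ball 0 1" and q0: "q 0 = 1"
    and bound: "\<And>z. z \<in> ball 0 1 \<Longrightarrow> norm (q z - 1) < 2 / 3"
  shows "q \<prec>\<^sub>D (\<lambda>z. 1 + z - z ^ 3 / 3)"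
proof -
  define h where "h = (\<lambda>z::complex. z - z ^ 3 / 3)"
  have h: "h holomorphic_on ball 0 1"
    unfolding h_def by (intro holomorphic_intros) auto
  have inj: "inj_on h (ball 0 1)"
    unfolding h_def by (rule inj_on_nephroid_cubic)
  obtain g where g: "g holomorphic_on h ` ball 0 1"
    and gh: "\<And>z. z \<in> ball 0 1 \<Longrightarrow> g (h z) = z"
    using holomorphic_has_inverse[OF h open_ball inj] by metis
  have inv: "norm (g c) < 1 \<and> h (g c) = c \<and> c \<in> h ` ball 0 1" if "norm c < 2 / 3" for c
  proof -
    obtain z where "norm z < 1" and "h z = c"
      unfolding h_def using \<open>norm c < 2 / 3\<close> by (rule nephroid_cubic_covers)
    then show ?thesis using gh[of z] by auto
  qed
  define w where "w = (\<lambda>z. g (q z - 1))"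
  have "g \<circ> (\<lambda>z. q z - 1) holomorphic_on ball 0 1"
  proof (rule holomorphic_on_compose_gen[OF _ g])
    show "(\<lambda>z. q z - 1) holomorphic_on ball 0 1" by (intro holomorphic_intros q)
    show "(\<lambda>z. q z - 1) ` ball 0 1 \<subseteq> h ` ball 0 1" using inv bound by blast
  qed
  then have "w holomorphic_on ball 0 1" by (simp add: w_def o_def)
  moreover have "w 0 = 0"
    using gh[of 0] by (simp add: w_def h_def q0)
  moreover have "norm (w z) < 1 \<and> q z = 1 + w z - w z ^ 3 / 3" if "z \<in> ball 0 1" for z
    using inv[OF bound[OF that]] by (simp add: w_def h_def algebra_simps)
  moreover have "(\<lambda>z::complex. 1 + z - z ^ 3 / 3) holomorphic_on ball 0 1"
    by (intro holomorphic_intros) auto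
  ultimately show ?thesis
    unfolding subordinate_def using q by blast
qed

text \<open>The difference equals (A - B)w/(1 + Bw), whose denominator has modulus at least 1 -
  |B||w|.\<close>

lemma norm_janowski_minus_1_less:
  fixes A B r :: real and w :: complex
  assumes "B \<le> A" and AB: "A - B \<le> r * (1 - \<bar>B\<bar>)" and B: "\<bar>B\<bar> < 1" and "0 < r" and w: "norm w < 1"
  shows "norm ((1 + of_real A * w) / (1 + of_real B * w) - 1) < r"
proof -
  have "\<bar>B\<bar> * norm w \<le> norm w" using B by (simp add: mult_left_le_one_le)
  moreover have low: "1 - \<bar>B\<bar> * norm w \<le> norm (1 + of_real B * w)"
    using norm_diff_ineq[of 1 "of_real B * w"] by (simp add: norm_mult)
  ultimately have pos: "0 < norm (1 + of_real B * w)" using w by linarith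
  have "(A - B) * norm w \<le> r * (1 - \<bar>B\<bar>) * norm w"
    using AB by (intro mult_right_mono) auto
  also have "\<dots> = r * (norm w - \<bar>B\<bar> * norm w)" by (simp add: algebra_simps)
  \<comment> \<open>Strictness comes from |w| < 1 in |w| - |B||w| < 1 - |B||w|, which also covers w
    = 0.\<close>
  also have "\<dots> < r * norm (1 + of_real B * w)"
    using w low \<open>0 < r\<close> by (intro mult_strict_left_mono) auto
  finally have less: "(A - B) * norm w < r * norm (1 + of_real B * w)" .
  have "(1 + of_real A * w) / (1 + of_real B * w) - 1 = of_real (A - B) * w / (1 + of_real B * w)"
    using pos by (auto simp: field_simps)
  then have "norm ((1 + of_real A * w) / (1 + of_real B * w) - 1)
      = (A - B) * norm w / norm (1 + of_real B * w)"
    using \<open>B \<le> A\<close> by (simp add: norm_divide norm_mult flip: of_real_diff)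
  with less pos show ?thesis by (simp add: divide_less_eq)
qed

theorem theorem3p3:
  fixes A B :: real
  assumes "-1 < B" and "B < A" and "A \<le> 1"
    and "(1 - B^2 < 3 * (1 - A * B) \<and> 3 * (1 - A * B) \<le> 3 * (1 - B^2) \<and> 1 - B \<le> 3 * (1 - A)) \<or>
         (3 * (1 - B^2) \<le> 3 * (1 - A * B) \<and> 3 * (1 - A * B) < 5 * (1 - B^2) \<and>
          3 * (1 + A) \<le> 5 * (1 + B))"
  shows "janowski_class A B \<subseteq> nephroid_class"
proof
  have bound: "A - B \<le> 2 / 3 * (1 - \<bar>B\<bar>)"
    using assms(4)
  proof
    \<comment> \<open>The middle inequality says (A - B)B \<ge> 0 and so fixes the sign of B; with
      |B| = B the last one rearranges to the bound. The other case is the mirror image, with |B| =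
      -B.\<close>
    assume a: "1 - B^2 < 3 * (1 - A * B) \<and> 3 * (1 - A * B) \<le> 3 * (1 - B^2) \<and> 1 - B \<le> 3 * (1 - A)"
    then have "0 \<le> (A - B) * B" by (simp add: algebra_simps power2_eq_square)
    then have "0 \<le> B" using assms(2) by (simp add: zero_le_mult_iff)
    then show ?thesis using a by simp
  next
    assume a: "3 * (1 - B^2) \<le> 3 * (1 - A * B) \<and> 3 * (1 - A * B) < 5 * (1 - B^2) \<and>
      3 * (1 + A) \<le> 5 * (1 + B)"
    then have "(A - B) * B \<le> 0" by (simp add: algebra_simps power2_eq_square)
    then have "B \<le> 0" using assms(2) by (simp add: mult_le_0_iff)
    then show ?thesis using a by simp
  qed
  fix f
  assume "f \<in> janowski_class A B"
  then have f: "f \<in> normalized_analytic"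
    and sub: "starlike_quotient f \<prec>\<^sub>D (\<lambda>z. (1 + of_real A * z) / (1 + of_real B * z))"
    by (auto simp: janowski_class_def)
  from sub obtain w where q: "starlike_quotient f holomorphic_on ball 0 1" and "w 0 = 0"
    and w: "\<And>z. z \<in> ball 0 1 \<Longrightarrow> norm (w z) < 1"
    and qw: "\<And>z. z \<in> ball 0 1 \<Longrightarrow>
      starlike_quotient f z = (1 + of_real A * w z) / (1 + of_real B * w z)"
    unfolding subordinate_def by blast
  have "starlike_quotient f \<prec>\<^sub>D (\<lambda>z. 1 + z - z ^ 3 / 3)"
  proof (rule subordinate_nephroidI[OF q])
    \<comment> \<open>The subordination itself determines the value at the removable singularity,
      since w(0) = 0.\<close>
    show "starlike_quotient f 0 = 1" using qw[of 0] \<open>w 0 = 0\<close> by simp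
    show "norm (starlike_quotient f z - 1) < 2 / 3" if "z \<in> ball 0 1" for z
      unfolding qw[OF that] using assms(1-3) bound w[OF that]
      by (intro norm_janowski_minus_1_less) auto
  qed
  with f show "f \<in> nephroid_class" by (simp add: nephroid_class_def)
qed

end
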